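(* Let $f:\mathbb{R}^n\to\mathbb{R}$ be twice continuously differentiable and bounded from below, and let $\{x_k\}$ be generated by the regularized quasi-Newton method described in the context, with matrices $B_k\in\mathbb{R}^{n\times n}$ such that $\{B_k\}$ is a bounded sequence. Write $g_k:=\nabla f(x_k)$. Suppose that $\nabla f$ is uniformly continuous on a set $X\subseteq\mathbb{R}^n$ satisfying $\{x_k\}\subseteq X$. Then $$\lim_{k\to\infty}\|g_k\|=0;$$ in particular, every accumulation point $\bar x$ of $\{x_k\}$ is a stationary point of $f$, i.e. $\nabla f(\bar x)=0$.
   Context: Notation: $\|\cdot\|$ is the Euclidean norm, $I$ the $n\times n$ identity, $g_k:=\nabla f(x_k)$. Regularized quasi-Newton method. Choose $x_0\in\mathbb{R}^n$ and parameters $\mu_0>0$; $p_{\min},c_1\in(0,1)$; $c_2\in(c_1,1)$; $\sigma_1\in(0,1)$; $\sigma_2>1$. For $k=0,1,2,\ldots$: Step 1. If a suitable stopping criterion is satisfied, terminate. (For asymptotic statements, the algorithm is considered as running without termination and producing an infinite sequence $\{x_k\}$.) Step 2 (step computation). Choose $B_k\in\mathbb{R}^{n\times n}$ (arbitrary; in particular not required to be symmetric, positive definite, or an approximation of the Hessian) and attempt to solve $(B_k+\mu_k I)d_k=-g_k$ for $d_k\in\mathbb{R}^n$. For a solution $d_k$, the predicted reduction is $$\mathrm{pred}_k:=-g_k^{\mathsf T}d_k-\tfrac12 d_k^{\mathsf T}B_kd_k=\tfrac{\mu_k}{2}\|d_k\|^2-\tfrac12 g_k^{\mathsf T}d_k.$$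 If the equation admits no solution $d_k$, or if $\mathrm{pred}_k\le p_{\min}\|g_k\|\,\|d_k\|$, set $x_{k+1}:=x_k$, $\mu_{k+1}:=\sigma_2\mu_k$ and go to Step 4. Otherwise go to Step 3. Step 3 (variable update). Let $\mathrm{ared}_k:=f(x_k)-f(x_k+d_k)$ and $\varrho_k:=\mathrm{ared}_k/\mathrm{pred}_k$. - If $\varrho_k\le c_1$: set $x_{k+1}:=x_k$, $\mu_{k+1}:=\sigma_2\mu_k$. - If $c_1<\varrho_k\le c_2$ (successful step): set $x_{k+1}:=x_k+d_k$, $\mu_{k+1}:=\mu_k$. - If $c_2<\varrho_k$ (highly successful step): set $x_{k+1}:=x_k+d_k$, $\mu_{k+1}:=\sigma_1\mu_k$. Step 4. Replace $k$ by $k+1$ and go to Step 1. *)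

theory Defs
  imports "HOL-Analysis.Analysis"
begin

text \<open>The value is only meaningful at points where the function is differentiable.\<close>

definition gradient :: "('a::real_inner \<Rightarrow> real) \<Rightarrow> 'a \<Rightarrow> 'a" where
  "gradient f x = (THE D. GDERIV f x :> D)"

lemma gradient_eqI:
  assumes "GDERIV f x :> D"
  shows "gradient f x = D"
  unfolding gradient_def
proof (rule the_equality)
  fix E assume "GDERIV f x :> E"
  then have "(\<lambda>h. h \<bullet> E) = (\<lambda>h. h \<bullet> D)"
    using assms unfolding gderiv_def by (rule has_derivative_unique)
  then have "(E - D) \<bullet> E = (E - D) \<bullet> D" by (rule fun_cong)
  then have "(E - D) \<bullet> (E - D) = 0" by (simp only: inner_diff_right diff_self)
  then show "E = D" by simp
qed (rule assms)

lemma GDERIV_gradient: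
  fixes f :: "'a::euclidean_space \<Rightarrow> real"
  assumes "f differentiable (at x)"
  shows "GDERIV f x :> gradient f x"
proof -
  obtain f' where f': "(f has_derivative f') (at x)"
    using assms unfolding differentiable_def by blast
  then have lin: "linear f'"
    by (simp add: has_derivative_linear)
  have "f' = (\<lambda>h. h \<bullet> adjoint f' 1)"
  proof
    fix h show "f' h = h \<bullet> adjoint f' 1"
      using adjoint_works[OF lin, of h 1] by simp
  qed
  with f' have D: "GDERIV f x :> adjoint f' 1"
    unfolding gderiv_def by (rule subst[where P = "\<lambda>g. (f has_derivative g) (at x)", rotated])
  show ?thesis
    unfolding gradient_eqI[OF D] by (rule D)
qed

text \<open>The matrix-valued function \<open>H\<close> is the Hessian, i.e. the Jacobian of the gradient.\<close>

definition twice_continuously_differentiable :: "(real ^ 'n \<Rightarrow> real) \<Rightarrow> bool" where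
  "twice_continuously_differentiable f \<longleftrightarrow>
     (\<forall>x. f differentiable (at x)) \<and>
     (\<exists>H :: real ^ 'n \<Rightarrow> real ^ 'n ^ 'n.
        (\<forall>x. (gradient f has_derivative (\<lambda>h. H x *v h)) (at x)) \<and>
        continuous_on UNIV H)"

definition qn_equation ::
  "(real ^ 'n \<Rightarrow> real) \<Rightarrow> real ^ 'n ^ 'n \<Rightarrow> real ^ 'n \<Rightarrow> real \<Rightarrow> real ^ 'n \<Rightarrow> bool" where
  "qn_equation f B x \<mu> d \<longleftrightarrow> (B + \<mu> *\<^sub>R mat 1) *v d = - gradient f x"

definition pred_red :: "(real ^ 'n \<Rightarrow> real) \<Rightarrow> real ^ 'n ^ 'n \<Rightarrow> real ^ 'n \<Rightarrow> real ^ 'n \<Rightarrow> real" where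
  "pred_red f B x d = - (gradient f x \<bullet> d) - 1 / 2 * (d \<bullet> (B *v d))"

lemma pred_red_alt:
  assumes "qn_equation f B x \<mu> d"
  shows "pred_red f B x d = \<mu> / 2 * (norm d)\<^sup>2 - 1 / 2 * (gradient f x \<bullet> d)"
proof -
  have "(B + \<mu> *\<^sub>R mat 1) *v d = B *v d + \<mu> *\<^sub>R d"
    by (simp only: matrix_vector_mult_add_rdistrib scaleR_matrix_vector_assoc[symmetric] matrix_vector_mul_lid)
  with assms have "B *v d + \<mu> *\<^sub>R d = - gradient f x"
    unfolding qn_equation_def by (rule back_subst[where P = "\<lambda>v. v = - gradient f x"])
  then have "B *v d = - gradient f x - \<mu> *\<^sub>R d"
    by (rule eq_diff_eq[THEN iffD2])
  then have "d \<bullet> (B *v d) = - (gradient f x \<bullet> d) - \<mu> * (norm d)\<^sup>2"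
    by (simp add: inner_diff_right power2_norm_eq_inner inner_commute[of d "gradient f x"])
  then show ?thesis
    unfolding pred_red_def by (simp add: field_simps)
qed

definition ared :: "(real ^ 'n \<Rightarrow> real) \<Rightarrow> real ^ 'n \<Rightarrow> real ^ 'n \<Rightarrow> real" where
  "ared f x d = f x - f (x + d)"

definition red_ratio :: "(real ^ 'n \<Rightarrow> real) \<Rightarrow> real ^ 'n ^ 'n \<Rightarrow> real ^ 'n \<Rightarrow> real ^ 'n \<Rightarrow> real" where
  "red_ratio f B x d = ared f x d / pred_red f B x d"

text \<open>
  \<open>rqn_step f pmin c1 c2 \<sigma>1 \<sigma>2 B x \<mu> x' \<mu>'\<close>: from the iterate \<open>x\<close> with regularization parameter \<open>\<mu>\<close>,
  one iteration with matrix \<open>B\<close> may produce \<open>x'\<close> and \<open>\<mu>'\<close>. This is a relation because a singular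
  system can have several solutions, any of which may be the computed step \<open>d\<close>.
\<close>

inductive rqn_step ::
  "(real ^ 'n \<Rightarrow> real) \<Rightarrow> real \<Rightarrow> real \<Rightarrow> real \<Rightarrow> real \<Rightarrow> real \<Rightarrow> real ^ 'n ^ 'n \<Rightarrow>
   real ^ 'n \<Rightarrow> real \<Rightarrow> real ^ 'n \<Rightarrow> real \<Rightarrow> bool"
  for f pmin c1 c2 \<sigma>1 \<sigma>2 B x \<mu>
where
  no_solution:
    "\<nexists>d. qn_equation f B x \<mu> d \<Longrightarrow>
     rqn_step f pmin c1 c2 \<sigma>1 \<sigma>2 B x \<mu> x (\<sigma>2 * \<mu>)"
| small_pred:
    "\<lbrakk>qn_equation f B x \<mu> d;
      pred_red f B x d \<le> pmin * norm (gradient f x) * norm d\<rbrakk> \<Longrightarrow>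
     rqn_step f pmin c1 c2 \<sigma>1 \<sigma>2 B x \<mu> x (\<sigma>2 * \<mu>)"
| unsuccessful:
    "\<lbrakk>qn_equation f B x \<mu> d;
      pred_red f B x d > pmin * norm (gradient f x) * norm d;
      red_ratio f B x d \<le> c1\<rbrakk> \<Longrightarrow>
     rqn_step f pmin c1 c2 \<sigma>1 \<sigma>2 B x \<mu> x (\<sigma>2 * \<mu>)"
| successful:
    "\<lbrakk>qn_equation f B x \<mu> d;
      pred_red f B x d > pmin * norm (gradient f x) * norm d;
      c1 < red_ratio f B x d; red_ratio f B x d \<le> c2\<rbrakk> \<Longrightarrow>
     rqn_step f pmin c1 c2 \<sigma>1 \<sigma>2 B x \<mu> (x + d) \<mu>"
| highly_successful:
    "\<lbrakk>qn_equation f B x \<mu> d;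
      pred_red f B x d > pmin * norm (gradient f x) * norm d;
      c2 < red_ratio f B x d\<rbrakk> \<Longrightarrow>
     rqn_step f pmin c1 c2 \<sigma>1 \<sigma>2 B x \<mu> (x + d) (\<sigma>1 * \<mu>)"

definition accumulation_point :: "(nat \<Rightarrow> 'a::topological_space) \<Rightarrow> 'a \<Rightarrow> bool" where
  "accumulation_point x a \<longleftrightarrow> (\<exists>r. strict_mono r \<and> (x \<circ> r) \<longlonglongrightarrow> a)"

end

theory Submission
  imports Defs
begin

text \<open>
  Every iteration satisfies \<open>c1 * pmin * norm g\<^sub>k * norm (x\<^sub>k\<^sub>+\<^sub>1 - x\<^sub>k) \<le> f x\<^sub>k - f x\<^sub>k\<^sub>+\<^sub>1\<close>, so on
  any stretch of indices on which the gradient norms stay above a fixed \<open>\<epsilon> > 0\<close> the path length is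
  controlled by the decrease of \<open>f\<close>, which tends to zero as \<open>f\<close> is bounded below.

  If the gradients were eventually bounded away from zero, the iterates would therefore converge.
  Near the limit every step with a large enough \<open>\<mu>\<^sub>k\<close> is accepted, so \<open>\<mu>\<^sub>k\<close> stays bounded and
  infinitely many steps are accepted; but \<open>norm g\<^sub>k \<le> (\<mu>\<^sub>k + M) * norm d\<^sub>k \<rightarrow> 0\<close> along them. Hence the
  lower limit of the gradient norms is zero. Finally, by the same path length bound, an iterate with
  large gradient is close to the next iterate with small gradient, which contradicts uniform continuity.
\<close>

section \<open>Operator bounds and the mean value theorem\<close>

text \<open>The matrix-vector product is bilinear on finite-dimensional spaces, hence bounded, so a
  common bound on the matrices gives a common operator bound.\<close>

lemma bounded_matrices_uniform_bound:
  fixes B :: "'i \<Rightarrow> real ^ 'n ^ 'm"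
  assumes "bounded (range B)"
  obtains M where "0 \<le> M" "\<And>k v. norm (B k *v v) \<le> M * norm v"
proof -
  obtain b where b: "\<And>k. norm (B k) \<le> b"
    using assms by (auto simp: bounded_iff)
  have "bilinear ((*v) :: real ^ 'n ^ 'm \<Rightarrow> real ^ 'n \<Rightarrow> real ^ 'm)"
    unfolding bilinear_def
    by (auto intro!: linearI simp: matrix_vector_mult_add_rdistrib matrix_vector_right_distrib
        scaleR_matrix_vector_assoc matrix_vector_mult_scaleR)
  then obtain K where K: "0 < K"
    "\<And>(A :: real ^ 'n ^ 'm) v. norm (A *v v) \<le> K * norm A * norm v"
    using bilinear_bounded_pos by blast
  have "norm (B k *v v) \<le> K * b * norm v" for k v
  proof -
    have "K * norm (B k) * norm v \<le> K * b * norm v"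
      using b[of k] K(1) by (intro mult_right_mono mult_left_mono) auto
    with K(2)[of "B k" v] show ?thesis by linarith
  qed
  moreover have "0 \<le> K * b"
    \<comment> \<open>Any index shows that \<open>b\<close> is nonnegative; \<open>undefined\<close>
      is one, as types are nonempty.\<close>
    using K(1) order_trans[OF norm_ge_zero b[of undefined]] by simp
  ultimately show ?thesis by (rule that[rotated])
qed

text \<open>One-variable mean value theorem along the segment from \<open>x\<close> to
  \<open>x + d\<close>. Of the intermediate point only its distance to \<open>x\<close> is kept,
  because the variation of the gradient is later controlled on balls.\<close>

lemma gradient_mean_value:
  fixes f :: "'a::euclidean_space \<Rightarrow> real"
  assumes "\<And>y. f differentiable (at y)"
  obtains z where "norm (z - x) \<le> norm d" "f (x + d) - f x = gradient f z \<bullet> d"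
proof -
  have "((\<lambda>t. f (x + t *\<^sub>R d)) has_real_derivative gradient f (x + t *\<^sub>R d) \<bullet> d) (at t)" for t
  proof -
    have "(f has_derivative (\<lambda>h. h \<bullet> gradient f (x + t *\<^sub>R d))) (at (x + t *\<^sub>R d))"
      using GDERIV_gradient[OF assms] unfolding gderiv_def .
    then have "((\<lambda>t. f (x + t *\<^sub>R d)) has_derivative (\<lambda>s. (s *\<^sub>R d) \<bullet> gradient f (x + t *\<^sub>R d))) (at t)"
      by (rule has_derivative_compose[rotated]) (auto intro!: derivative_eq_intros)
    then show ?thesis
      by (rule has_derivative_imp_has_field_derivative) (simp add: inner_commute)
  qed
  then obtain t :: real where t: "0 < t" "t < 1"
    "f (x + 1 *\<^sub>R d) - f (x + 0 *\<^sub>R d) = (1 - 0) * (gradient f (x + t *\<^sub>R d) \<bullet> d)"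
    using MVT2[of 0 1 "\<lambda>t. f (x + t *\<^sub>R d)" "\<lambda>t. gradient f (x + t *\<^sub>R d) \<bullet> d"] by auto
  show ?thesis
  proof
    show "norm (x + t *\<^sub>R d - x) \<le> norm d"
      using t by (simp add: mult_left_le_one_le)
  qed (use t in simp)
qed

section \<open>The regularized equation\<close>

lemma qn_equation_iff:
  "qn_equation f B x \<mu> d \<longleftrightarrow> gradient f x = - (B *v d + \<mu> *\<^sub>R d)"
proof -
  have "(B + \<mu> *\<^sub>R mat 1) *v d = B *v d + \<mu> *\<^sub>R d"
    by (simp only: matrix_vector_mult_add_rdistrib scaleR_matrix_vector_assoc[symmetric] matrix_vector_mul_lid)
  then show ?thesis
    unfolding qn_equation_def by (metis minus_minus)
qed

lemma norm_gradient_qn_equation: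
  assumes "qn_equation f B x \<mu> d"
  shows "norm (gradient f x) = norm (B *v d + \<mu> *\<^sub>R d)"
  using assms unfolding qn_equation_iff by (simp only: norm_minus_cancel)

text \<open>For \<open>\<mu> > M\<close> this coercivity yields both the solvability of the equation
  and an upper bound on the length of its solutions.\<close>

lemma norm_shifted_mult_ge:
  fixes B :: "real ^ 'n ^ 'n"
  assumes "norm (B *v d) \<le> M * norm d"
  shows "(\<mu> - M) * norm d \<le> norm (B *v d + \<mu> *\<^sub>R d)"
proof -
  have "\<mu> * norm d \<le> norm (\<mu> *\<^sub>R d)"
    by (simp add: mult_right_mono)
  also have "\<dots> \<le> norm (B *v d + \<mu> *\<^sub>R d) + norm (B *v d)"
    using norm_triangle_ineq4[of "B *v d + \<mu> *\<^sub>R d" "B *v d"] by simp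
  finally show ?thesis
    using assms by (simp add: algebra_simps)
qed

lemma norm_gradient_le_of_qn_equation:
  assumes "qn_equation f B x \<mu> d" "norm (B *v d) \<le> M * norm d" "0 \<le> \<mu>"
  shows "norm (gradient f x) \<le> (\<mu> + M) * norm d"
  using assms norm_triangle_ineq[of "B *v d" "\<mu> *\<^sub>R d"]
  by (simp add: norm_gradient_qn_equation algebra_simps)

text \<open>Coercivity makes the kernel of the shifted matrix trivial, and an injective endomorphism
  in finite dimension is surjective.\<close>

lemma qn_equation_solvable:
  assumes M: "\<And>v. norm (B *v v) \<le> M * norm v" and "M < \<mu>"
  shows "\<exists>d. qn_equation f B x \<mu> d"
proof -
  have lin: "linear (\<lambda>d. B *v d + \<mu> *\<^sub>R d)"
    by (auto intro!: linearI simp: matrix_vector_right_distrib matrix_vector_mult_scaleR algebra_simps)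
  have "d = 0" if "B *v d + \<mu> *\<^sub>R d = 0" for d
    using norm_shifted_mult_ge[OF M[of d], of \<mu>] that \<open>M < \<mu>\<close> by (simp add: mult_le_0_iff)
  then have "inj (\<lambda>d. B *v d + \<mu> *\<^sub>R d)"
    using linear_injective_0[OF lin] by blast
  then have "surj (\<lambda>d. B *v d + \<mu> *\<^sub>R d)"
    by (rule linear_inj_imp_surj[OF lin])
  from surjD[OF this, of "- gradient f x"] obtain d where "- gradient f x = B *v d + \<mu> *\<^sub>R d"
    by blast
  then have "gradient f x = - (B *v d + \<mu> *\<^sub>R d)"
    by (simp only: minus_equation_iff[of "gradient f x"])
  then show ?thesis
    unfolding qn_equation_iff by blast
qed

section \<open>Acceptance of steps with large regularization\<close>

text \<open>Pairing the equation with \<open>d\<close> turns the predicted reduction into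
  \<open>\<mu> * (norm d)\<^sup>2 + 1 / 2 * (d \<bullet> (B *v d))\<close>. Both sides are then
  compared with multiples of \<open>(norm d)\<^sup>2\<close>, and the assumed inequality compares
  the coefficients. It holds for all large \<open>\<mu>\<close> once
  \<open>pmin < 1\<close>.\<close>

lemma pred_red_gt:
  assumes qn: "qn_equation f B x \<mu> d" and M: "norm (B *v d) \<le> M * norm d"
    and "0 \<le> \<mu>" "0 < pmin" "pmin * (\<mu> + M) < \<mu> - M / 2" "gradient f x \<noteq> 0"
  shows "pmin * norm (gradient f x) * norm d < pred_red f B x d"
proof -
  have "d \<noteq> 0"
    using qn \<open>gradient f x \<noteq> 0\<close> by (auto simp: qn_equation_iff)
  have "\<bar>d \<bullet> (B *v d)\<bar> \<le> norm d * norm (B *v d)"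
    by (rule Cauchy_Schwarz_ineq2)
  also have "\<dots> \<le> norm d * (M * norm d)"
    by (intro mult_left_mono M) simp
  finally have dBd: "- (M * (norm d)\<^sup>2) \<le> d \<bullet> (B *v d)"
    by (simp add: power2_eq_square algebra_simps)
  have gd: "gradient f x \<bullet> d = - (d \<bullet> (B *v d)) - \<mu> * (norm d)\<^sup>2"
    using qn unfolding qn_equation_iff
    by (simp only: inner_minus_left inner_add_left inner_scaleR_left inner_diff_left power2_norm_eq_inner
        inner_commute[of "B *v d"] minus_add_distrib add_uminus_conv_diff)
  have "pmin * norm (gradient f x) * norm d \<le> pmin * ((\<mu> + M) * norm d) * norm d"
    using norm_gradient_le_of_qn_equation[OF qn M \<open>0 \<le> \<mu>\<close>] \<open>0 < pmin\<close>
    by (intro mult_right_mono mult_left_mono) auto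
  also have "\<dots> = pmin * (\<mu> + M) * (norm d)\<^sup>2"
    by (simp add: power2_eq_square)
  also have "\<dots> < (\<mu> - M / 2) * (norm d)\<^sup>2"
    using assms \<open>d \<noteq> 0\<close> by (intro mult_strict_right_mono) auto
  also have "\<dots> \<le> \<mu> * (norm d)\<^sup>2 + 1 / 2 * (d \<bullet> (B *v d))"
    using dBd by (simp add: algebra_simps)
  also have "\<dots> = pred_red f B x d"
    unfolding pred_red_alt[OF qn] gd by (simp add: field_simps)
  finally show ?thesis .
qed

text \<open>Predicted and actual reduction share the linear term, so they differ only by the
  gradient variation along the step and by the quadratic term. By \<open>small\<close> and the
  predicted reduction test this difference is less than \<open>(1 - c1)\<close> times the predicted
  reduction.\<close>

lemma red_ratio_gt:
  assumes diff: "\<And>y. f differentiable (at y)"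
    and M: "norm (B *v d) \<le> M * norm d"
    and "0 < pmin" "c1 < 1"
    and pred: "pmin * norm (gradient f x) * norm d < pred_red f B x d"
    and grad: "\<And>y. norm (y - x) \<le> norm d \<Longrightarrow> norm (gradient f y - gradient f x) \<le> \<eta>"
    and small: "\<eta> + M / 2 * norm d \<le> (1 - c1) * pmin * norm (gradient f x)"
  shows "c1 < red_ratio f B x d"
proof -
  obtain z where z: "norm (z - x) \<le> norm d" "f (x + d) - f x = gradient f z \<bullet> d"
    using gradient_mean_value[OF diff] by blast
  have "(gradient f z - gradient f x) \<bullet> d \<le> norm (gradient f z - gradient f x) * norm d"
    by (rule norm_cauchy_schwarz)
  also have "\<dots> \<le> \<eta> * norm d"
    by (intro mult_right_mono grad z) simp
  finally have ared: "- (gradient f x \<bullet> d) - \<eta> * norm d \<le> ared f x d"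
    using z(2) by (simp add: ared_def inner_diff_left)
  have "\<bar>d \<bullet> (B *v d)\<bar> \<le> norm d * norm (B *v d)"
    by (rule Cauchy_Schwarz_ineq2)
  also have "\<dots> \<le> norm d * (M * norm d)"
    by (intro mult_left_mono M) simp
  finally have "- (M * norm d * norm d) \<le> d \<bullet> (B *v d)"
    by (simp add: algebra_simps)
  with ared have "pred_red f B x d - ared f x d \<le> (\<eta> + M / 2 * norm d) * norm d"
    unfolding pred_red_def by (simp add: algebra_simps)
  also have "\<dots> \<le> (1 - c1) * pmin * norm (gradient f x) * norm d"
    by (intro mult_right_mono small) simp
  also have "\<dots> < (1 - c1) * pred_red f B x d"
    using pred \<open>c1 < 1\<close> by (simp add: mult.assoc)
  finally have "c1 * pred_red f B x d < ared f x d"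
    by (simp add: algebra_simps)
  moreover have "0 \<le> pmin * norm (gradient f x) * norm d"
    using \<open>0 < pmin\<close> by simp
  then have "0 < pred_red f B x d"
    using pred by linarith
  ultimately show ?thesis
    unfolding red_ratio_def by (simp add: pos_less_divide_eq)
qed

text \<open>Coercivity and \<open>short\<close> force every solution \<open>d\<close> to have length
  at most \<open>\<rho>\<close>, so both tests are passed and the three rejecting rules are
  impossible. Acceptance is expressed through \<open>\<mu>'\<close> because the growth of the
  parameter is what has to be excluded.\<close>

lemma rqn_step_accepted:
  assumes step: "rqn_step f pmin c1 c2 \<sigma>1 \<sigma>2 B x \<mu> x' \<mu>'"
    and diff: "\<And>y. f differentiable (at y)"
    and M: "0 \<le> M" "\<And>v. norm (B *v v) \<le> M * norm v"
    and "0 < pmin" "c1 < 1"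
    and \<mu>: "M < \<mu>" "pmin * (\<mu> + M) < \<mu> - M / 2"
    and "gradient f x \<noteq> 0"
    and short: "norm (gradient f x) \<le> (\<mu> - M) * \<rho>"
    and grad: "\<And>y. norm (y - x) \<le> \<rho> \<Longrightarrow> norm (gradient f y - gradient f x) \<le> \<eta>"
    and small: "\<eta> + M / 2 * \<rho> \<le> (1 - c1) * pmin * norm (gradient f x)"
  shows "\<mu>' = \<mu> \<or> \<mu>' = \<sigma>1 * \<mu>"
proof -
  have pred: "pmin * norm (gradient f x) * norm d < pred_red f B x d" if "qn_equation f B x \<mu> d" for d
    using M(1) \<mu>(1) by (intro pred_red_gt[OF that M(2) _ \<open>0 < pmin\<close> \<mu>(2) \<open>gradient f x \<noteq> 0\<close>]) simp
  have ratio: "c1 < red_ratio f B x d" if "qn_equation f B x \<mu> d" for d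
  proof -
    have "(\<mu> - M) * norm d \<le> norm (gradient f x)"
      using norm_shifted_mult_ge[OF M(2)[of d], of \<mu>] that by (simp add: norm_gradient_qn_equation)
    then have "(\<mu> - M) * norm d \<le> (\<mu> - M) * \<rho>"
      using short by (rule order_trans)
    then have d: "norm d \<le> \<rho>"
      using \<mu>(1) by simp
    have "\<eta> + M / 2 * norm d \<le> (1 - c1) * pmin * norm (gradient f x)"
      using small mult_left_mono[OF d, of "M / 2"] M(1) by linarith
    then show ?thesis
      using red_ratio_gt[OF diff M(2) \<open>0 < pmin\<close> \<open>c1 < 1\<close> pred[OF that] grad] d by force
  qed
  from step show ?thesis
  proof cases
    case no_solution
    then show ?thesis
      using qn_equation_solvable[OF M(2) \<mu>(1)] by blast
  next
    case (small_pred d)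
    then show ?thesis
      using pred[of d] by linarith
  next
    case (unsuccessful d)
    then show ?thesis
      using ratio[of d] by linarith
  qed simp_all
qed

section \<open>Descent and path length along the iteration\<close>

locale rqn_sequence =
  fixes f :: "real ^ 'n \<Rightarrow> real"
    and x :: "nat \<Rightarrow> real ^ 'n"
    and \<mu> :: "nat \<Rightarrow> real"
    and B :: "nat \<Rightarrow> real ^ 'n ^ 'n"
    and pmin c1 c2 \<sigma>1 \<sigma>2 M :: real
  assumes diff: "\<And>y. f differentiable (at y)"
    and cont: "continuous_on UNIV (gradient f)"
    and bdd: "bdd_below (range f)"
    and \<mu>_0: "\<mu> 0 > 0"
    and pmin: "0 < pmin" "pmin < 1"
    and c: "0 < c1" "c1 < 1" "c1 < c2"
    and \<sigma>1: "0 < \<sigma>1" "\<sigma>1 < 1"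
    and \<sigma>2: "1 < \<sigma>2"
    and step: "\<And>k. rqn_step f pmin c1 c2 \<sigma>1 \<sigma>2 (B k) (x k) (\<mu> k) (x (Suc k)) (\<mu> (Suc k))"
    and M: "0 \<le> M" "\<And>k v. norm (B k *v v) \<le> M * norm v"
begin

lemma \<mu>_pos: "0 < \<mu> k"
proof (induction k)
  case (Suc k)
  from step[of k] show ?case
    using Suc \<sigma>1 \<sigma>2 by cases auto
qed (rule \<mu>_0)

lemma \<mu>_Suc_le: "\<mu> (Suc k) \<le> \<sigma>2 * \<mu> k"
  using step[of k]
proof cases
  case highly_successful
  then show ?thesis
    using \<mu>_pos[of k] \<sigma>1 \<sigma>2 by (simp add: mult_right_mono)
qed (use \<mu>_pos[of k] \<sigma>2 in auto)

text \<open>The three rejecting rules have the same effect, and since \<open>c1 < c2\<close> both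
  accepting rules give a ratio above \<open>c1\<close>.\<close>

lemma step_dichotomy:
  obtains (failed) "x (Suc k) = x k" "\<mu> (Suc k) = \<sigma>2 * \<mu> k"
  | (moved) d where "qn_equation f (B k) (x k) (\<mu> k) d" "x (Suc k) = x k + d"
    "pmin * norm (gradient f (x k)) * norm d < pred_red f (B k) (x k) d"
    "c1 < red_ratio f (B k) (x k) d"
  using step[of k]
proof cases
  case (highly_successful d)
  then show ?thesis
    using c(3) by (intro moved[of d]) auto
qed (use that in blast)+

text \<open>On an accepted step the ratio test and the predicted reduction test are chained; on a
  rejected step both sides vanish.\<close>

lemma descent:
  "c1 * pmin * norm (gradient f (x k)) * norm (x (Suc k) - x k) \<le> f (x k) - f (x (Suc k))"
proof (cases k rule: step_dichotomy)
  case (moved d)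
  have "0 \<le> pmin * norm (gradient f (x k)) * norm d"
    using pmin by simp
  then have "0 < pred_red f (B k) (x k) d"
    using moved by linarith
  then have "c1 * pred_red f (B k) (x k) d < ared f (x k) d"
    using moved by (simp add: red_ratio_def pos_less_divide_eq)
  moreover have "c1 * (pmin * norm (gradient f (x k)) * norm d) \<le> c1 * pred_red f (B k) (x k) d"
    using moved c by (intro mult_left_mono) auto
  ultimately show ?thesis
    using moved by (simp add: ared_def mult.assoc)
qed simp

lemma f_decseq: "decseq (\<lambda>k. f (x k))"
proof (rule decseq_SucI)
  fix k
  have "0 \<le> c1 * pmin * norm (gradient f (x k)) * norm (x (Suc k) - x k)"
    using c pmin by simp
  with descent[of k] show "f (x (Suc k)) \<le> f (x k)" by linarith
qed

lemma f_Cauchy: "Cauchy (\<lambda>k. f (x k))"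
proof -
  obtain b where "\<And>y. b \<le> f y"
    using bdd by (auto simp: bdd_below_def)
  then show ?thesis
    using decseq_convergent[OF f_decseq, of b] by (metis LIMSEQ_imp_Cauchy)
qed

text \<open>The descent inequality telescopes, with the triangle inequality for the
  distances.\<close>

lemma dist_iterates_le:
  assumes "m \<le> n" "\<And>j. m \<le> j \<Longrightarrow> j < n \<Longrightarrow> \<epsilon> \<le> norm (gradient f (x j))"
  shows "c1 * pmin * \<epsilon> * norm (x n - x m) \<le> f (x m) - f (x n)"
proof (cases "0 \<le> \<epsilon>")
  case True
  from assms show ?thesis
  proof (induction n rule: dec_induct)
    case (step n)
    have "c1 * pmin * \<epsilon> * norm (x (Suc n) - x m)
        \<le> c1 * pmin * \<epsilon> * norm (x (Suc n) - x n) + c1 * pmin * \<epsilon> * norm (x n - x m)"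
      unfolding distrib_left[symmetric]
      using c pmin True norm_triangle_ineq[of "x (Suc n) - x n" "x n - x m"]
      by (intro mult_left_mono) auto
    moreover have "c1 * pmin * \<epsilon> * norm (x (Suc n) - x n)
        \<le> c1 * pmin * norm (gradient f (x n)) * norm (x (Suc n) - x n)"
      using step c pmin by (intro mult_right_mono mult_left_mono) auto
    ultimately show ?case
      using descent[of n] step.IH step.prems by fastforce
  qed simp
next
  \<comment> \<open>For negative \<open>\<epsilon>\<close> the left side is at most zero, and
    monotonicity of the function values suffices.\<close>
  case False
  then have "c1 * pmin * \<epsilon> * norm (x n - x m) \<le> 0"
    using c pmin by (simp add: mult_le_0_iff zero_le_mult_iff)
  with decseqD[OF f_decseq \<open>m \<le> n\<close>] show ?thesis by linarith
qed

text \<open>The Cauchy property of the function values transfers to the iterates as long as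
  gradients stay large. The threshold \<open>N\<close> does not depend on the stretch, so it serves
  both an infinite tail and finite stretches of unknown length.\<close>

lemma iterates_Cauchy_on_stretches:
  assumes "0 < \<epsilon>" "0 < r"
  obtains N where
    "\<And>m n. N \<le> m \<Longrightarrow> m \<le> n \<Longrightarrow> (\<And>j. m \<le> j \<Longrightarrow> j < n \<Longrightarrow> \<epsilon> \<le> norm (gradient f (x j)))
      \<Longrightarrow> norm (x n - x m) < r"
proof -
  have C: "0 < c1 * pmin * \<epsilon>"
    using c pmin assms by simp
  with \<open>0 < r\<close> obtain N where
    N: "\<And>m n. N \<le> m \<Longrightarrow> N \<le> n \<Longrightarrow> dist (f (x m)) (f (x n)) < c1 * pmin * \<epsilon> * r"
    using f_Cauchy unfolding Cauchy_def by (metis mult_pos_pos)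
  show ?thesis
  proof
    fix m n
    assume "N \<le> m" "m \<le> n" "\<And>j. m \<le> j \<Longrightarrow> j < n \<Longrightarrow> \<epsilon> \<le> norm (gradient f (x j))"
    then have "c1 * pmin * \<epsilon> * norm (x n - x m) < c1 * pmin * \<epsilon> * r"
      using dist_iterates_le[of m n \<epsilon>] N[of m n] by (auto simp: dist_real_def)
    then show "norm (x n - x m) < r"
      using C by (simp only: mult_less_cancel_left_pos)
  qed
qed

section \<open>Boundedness of the regularization parameter\<close>

text \<open>Near \<open>a\<close> the quantities in the acceptance criterion can be bounded
  uniformly, so a single threshold \<open>T\<close> forces acceptance on the whole tail.\<close>

lemma \<mu>_eventually_bounded:
  assumes lim: "x \<longlonglongrightarrow> a" and "0 < \<epsilon>"
    and far: "\<forall>\<^sub>F k in sequentially. \<epsilon> \<le> norm (gradient f (x k))"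
  obtains S where "\<forall>\<^sub>F k in sequentially. \<mu> k \<le> S"
proof -
  define \<kappa> where "\<kappa> = (1 - c1) * pmin * \<epsilon>"
  have \<kappa>: "0 < \<kappa>"
    using c pmin \<open>0 < \<epsilon>\<close> by (simp add: \<kappa>_def)
  have "isCont (gradient f) a"
    using cont by (simp add: continuous_on_eq_continuous_at)
  \<comment> \<open>Two comparisons with the gradient at \<open>a\<close> cost
    \<open>\<kappa> / 2\<close> in total; the other half of \<open>\<kappa>\<close> is left for the
    term \<open>M / 2 * \<rho>\<close>.\<close>
  then obtain r where r: "0 < r"
    "\<And>y. dist y a < r \<Longrightarrow> dist (gradient f y) (gradient f a) < \<kappa> / 4"
    using \<kappa> unfolding continuous_at_eps_delta by (metis divide_pos_pos zero_less_numeral)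
  \<comment> \<open>The first entry keeps the \<open>\<rho>\<close>-ball around an iterate within
    \<open>r / 2\<close> of \<open>a\<close> inside the \<open>r\<close>-ball around
    \<open>a\<close>. The second gives \<open>M * \<rho> \<le> \<kappa>\<close>, where
    \<open>M + 1\<close> avoids division by zero.\<close>
  define \<rho> where "\<rho> = min (r / 2) (\<kappa> / (M + 1))"
  have \<rho>: "0 < \<rho>" "\<rho> \<le> r / 2"
    using r \<kappa> M(1) min.cobounded1[of "r / 2"] by (auto simp: \<rho>_def simp del: min.cobounded1)
  have "M * \<rho> \<le> M * (\<kappa> / (M + 1))"
    using M(1) by (intro mult_left_mono) (auto simp: \<rho>_def)
  also have "\<dots> \<le> \<kappa>"
    using M(1) \<kappa> by (simp add: field_simps)
  finally have M\<rho>: "M * \<rho> \<le> \<kappa>" .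
  define G where "G = norm (gradient f a) + \<kappa> / 4"
  have "0 \<le> G"
    using \<kappa> by (simp add: G_def)
  \<comment> \<open>\<open>M + 1\<close> gives \<open>\<mu> k > M\<close>, and
    \<open>G / \<rho>\<close> makes the steps short, \<open>G\<close> being a bound on the gradients
    near \<open>a\<close>. With \<open>s = \<mu> k - M\<close>, the coefficient inequality reads
    \<open>s * (1 - pmin) > (2 * pmin - 1 / 2) * M\<close>, for which the third summand suffices as
    \<open>pmin < 1\<close>.\<close>
  define T where "T = M + G / \<rho> + 3 * M / (2 * (1 - pmin)) + 1"
  have T_parts: "0 \<le> G / \<rho>" "0 \<le> 3 * M / (2 * (1 - pmin))"
    using \<open>0 \<le> G\<close> \<rho> M(1) pmin by auto
  have "\<forall>\<^sub>F k in sequentially. dist (x k) a < r / 2"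
    using tendstoD[OF lim, of "r / 2"] r(1) by simp
  with far obtain K where K:
    "\<And>k. K \<le> k \<Longrightarrow> dist (x k) a < r / 2 \<and> \<epsilon> \<le> norm (gradient f (x k))"
    using eventually_conj[of "\<lambda>k. dist (x k) a < r / 2" sequentially] unfolding eventually_sequentially by metis
  have dec: "\<mu> (Suc k) \<le> \<mu> k" if "K \<le> k" "T \<le> \<mu> k" for k
  proof -
    have close: "dist (x k) a < r / 2" and g: "\<epsilon> \<le> norm (gradient f (x k))"
      using K[OF that(1)] by auto
    have gk: "dist (gradient f (x k)) (gradient f a) < \<kappa> / 4"
      using close r by (intro r(2)) linarith
    have "\<mu> (Suc k) = \<mu> k \<or> \<mu> (Suc k) = \<sigma>1 * \<mu> k"
    proof (rule rqn_step_accepted[OF step diff M pmin(1) c(2)])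
      show "M < \<mu> k"
        using that T_parts by (simp add: T_def)
      have "3 * M / (2 * (1 - pmin)) < \<mu> k - M"
        using that T_parts by (simp add: T_def)
      then have "3 * M < (\<mu> k - M) * (2 * (1 - pmin))"
        using pmin by (simp add: pos_divide_less_eq)
      moreover have "pmin * M \<le> M"
        using pmin M(1) by (simp add: mult_left_le_one_le)
      ultimately show "pmin * (\<mu> k + M) < \<mu> k - M / 2"
        using M(1) by (simp add: algebra_simps)
      show "gradient f (x k) \<noteq> 0"
        using g \<open>0 < \<epsilon>\<close> by auto
      have "norm (gradient f (x k)) \<le> G"
        using gk norm_triangle_sub[of "gradient f (x k)" "gradient f a"] by (simp add: G_def dist_norm)
      also have "G = G / \<rho> * \<rho>"
        using \<rho> by simp
      also have "\<dots> \<le> (\<mu> k - M) * \<rho>"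
        using that T_parts \<rho> by (intro mult_right_mono) (auto simp: T_def)
      finally show "norm (gradient f (x k)) \<le> (\<mu> k - M) * \<rho>" .
      show "norm (gradient f y - gradient f (x k)) \<le> \<kappa> / 2" if "norm (y - x k) \<le> \<rho>" for y
      proof -
        have "dist y a < r"
          using that \<rho>(2) close dist_triangle[of y a "x k"] by (simp add: dist_norm)
        from r(2)[OF this] gk show ?thesis
          using dist_triangle2[of "gradient f y" "gradient f (x k)" "gradient f a"] by (simp add: dist_norm)
      qed
      have "\<kappa> \<le> (1 - c1) * pmin * norm (gradient f (x k))"
        unfolding \<kappa>_def using c pmin g by (intro mult_left_mono) auto
      then show "\<kappa> / 2 + M / 2 * \<rho> \<le> (1 - c1) * pmin * norm (gradient f (x k))"
        using M\<rho> by simp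
    qed
    then show ?thesis
      using \<mu>_pos[of k] \<sigma>1 by auto
  qed
  \<comment> \<open>From \<open>T\<close> upwards the parameter cannot grow, and from below
    \<open>T\<close> one iteration reaches at most \<open>\<sigma>2 * T\<close>.\<close>
  have "\<mu> k \<le> max (\<mu> K) (\<sigma>2 * T)" if "K \<le> k" for k
    using that
  proof (induction k rule: dec_induct)
    case (step k)
    show ?case
    proof (cases "T \<le> \<mu> k")
      case True
      with dec[OF step(1)] step show ?thesis by linarith
    next
      case False
      then have "\<sigma>2 * \<mu> k \<le> \<sigma>2 * T"
        using \<sigma>2 by (intro mult_left_mono) auto
      with \<mu>_Suc_le[of k] show ?thesis by linarith
    qed
  qed simp
  then show ?thesis
    by (intro that) (auto simp: eventually_sequentially)
qed

section \<open>The lower limit of the gradient norms\<close>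

text \<open>Eventual rejection of all steps would make the parameter grow geometrically with ratio
  \<open>\<sigma>2 > 1\<close>, past any bound.\<close>

lemma frequently_moved:
  assumes "\<forall>\<^sub>F k in sequentially. \<mu> k \<le> S"
  shows "\<exists>\<^sub>F k in sequentially. \<exists>d. qn_equation f (B k) (x k) (\<mu> k) d \<and> x (Suc k) = x k + d"
proof (rule ccontr)
  assume "\<not> ?thesis"
  with assms have "\<forall>\<^sub>F k in sequentially. \<mu> k \<le> S \<and>
      (\<nexists>d. qn_equation f (B k) (x k) (\<mu> k) d \<and> x (Suc k) = x k + d)"
    unfolding not_frequently by (rule eventually_conj)
  then obtain N where N: "\<And>k. N \<le> k \<Longrightarrow> \<mu> k \<le> S"
    "\<And>k d. N \<le> k \<Longrightarrow> \<not> (qn_equation f (B k) (x k) (\<mu> k) d \<and> x (Suc k) = x k + d)"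
    unfolding eventually_sequentially by blast
  have grow: "\<mu> (Suc k) = \<sigma>2 * \<mu> k" if "N \<le> k" for k
    by (cases k rule: step_dichotomy) (use N(2)[OF that] in auto)
  have pow: "\<mu> (N + j) = \<sigma>2 ^ j * \<mu> N" for j
    by (induction j) (simp_all add: grow)
  obtain j where "S / \<mu> N < \<sigma>2 ^ j"
    using real_arch_pow[OF \<sigma>2] by blast
  then have "S < \<mu> (N + j)"
    using \<mu>_pos[of N] by (simp add: pow pos_divide_less_eq)
  with N(1)[of "N + j"] show False by simp
qed

lemma frequently_small_gradient:
  assumes "0 < \<epsilon>"
  shows "\<exists>\<^sub>F k in sequentially. norm (gradient f (x k)) < \<epsilon>"
proof (rule ccontr)
  assume "\<not> ?thesis"
  then have far: "\<forall>\<^sub>F k in sequentially. \<epsilon> \<le> norm (gradient f (x k))"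
    by (simp add: not_frequently not_less)
  then obtain K where K: "\<And>k. K \<le> k \<Longrightarrow> \<epsilon> \<le> norm (gradient f (x k))"
    by (auto simp: eventually_sequentially)
  have "Cauchy x"
  proof (rule CauchyI')
    fix r :: real assume "0 < r"
    obtain N where N: "\<And>m n. N \<le> m \<Longrightarrow> m \<le> n \<Longrightarrow>
        (\<And>j. m \<le> j \<Longrightarrow> j < n \<Longrightarrow> \<epsilon> \<le> norm (gradient f (x j))) \<Longrightarrow> norm (x n - x m) < r"
      using iterates_Cauchy_on_stretches[OF assms \<open>0 < r\<close>] by blast
    have "dist (x m) (x n) < r" if "max K N \<le> m" "m < n" for m n
      using N[of m n] K that by (simp add: dist_norm norm_minus_commute)
    then show "\<exists>M. \<forall>m\<ge>M. \<forall>n>m. dist (x m) (x n) < r" by blast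
  qed
  then obtain a where a: "x \<longlonglongrightarrow> a"
    using Cauchy_convergent_iff convergent_def by blast
  obtain S where S: "\<forall>\<^sub>F k in sequentially. \<mu> k \<le> S"
    using \<mu>_eventually_bounded[OF a assms far] .
  \<comment> \<open>At an accepted step the displacement is \<open>d\<close>, so once
    \<open>\<mu> k \<le> S\<close> this sequence dominates the gradient norm there.\<close>
  have "(\<lambda>k. (S + M) * norm (x (Suc k) - x k)) \<longlonglongrightarrow> (S + M) * norm (a - a)"
    by (intro tendsto_intros LIMSEQ_Suc a)
  then have "\<forall>\<^sub>F k in sequentially. (S + M) * norm (x (Suc k) - x k) < \<epsilon>"
    using assms by (intro order_tendstoD) auto
  with S far have "\<forall>\<^sub>F k in sequentially.
      \<not> (\<exists>d. qn_equation f (B k) (x k) (\<mu> k) d \<and> x (Suc k) = x k + d)"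
  proof eventually_elim
    case (elim k)
    show ?case
    proof safe
      fix d assume d: "qn_equation f (B k) (x k) (\<mu> k) d" "x (Suc k) = x k + d"
      have "norm (gradient f (x k)) \<le> (\<mu> k + M) * norm d"
        by (rule norm_gradient_le_of_qn_equation[OF d(1) M(2)]) (rule less_imp_le[OF \<mu>_pos])
      also have "\<dots> \<le> (S + M) * norm d"
        using elim by (intro mult_right_mono) auto
      finally show False
        using elim d(2) by simp
    qed
  qed
  with frequently_moved[OF S] show False
    by (simp add: frequently_def)
qed

section \<open>Convergence of the whole sequence\<close>

lemma gradient_tendsto_zero:
  assumes uc: "uniformly_continuous_on X (gradient f)" and X: "range x \<subseteq> X"
  shows "(\<lambda>k. gradient f (x k)) \<longlonglongrightarrow> 0"
proof (rule LIMSEQ_I)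
  fix \<epsilon> :: real assume "0 < \<epsilon>"
  then have half: "0 < \<epsilon> / 2" by simp
  obtain r where r: "0 < r"
    "\<And>u v. u \<in> X \<Longrightarrow> v \<in> X \<Longrightarrow> dist v u < r \<Longrightarrow> dist (gradient f v) (gradient f u) < \<epsilon> / 2"
    using uc half unfolding uniformly_continuous_on_def by meson
  obtain N where N: "\<And>m n. N \<le> m \<Longrightarrow> m \<le> n \<Longrightarrow>
      (\<And>j. m \<le> j \<Longrightarrow> j < n \<Longrightarrow> \<epsilon> / 2 \<le> norm (gradient f (x j))) \<Longrightarrow> norm (x n - x m) < r"
    using iterates_Cauchy_on_stretches[OF half r(1)] by blast
  have "norm (gradient f (x m)) < \<epsilon>" if "N \<le> m" for m
  proof -
    \<comment> \<open>Minimality keeps the gradients at least \<open>\<epsilon> / 2\<close> from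
      \<open>m\<close> up to \<open>n\<close>, so \<open>x m\<close> and \<open>x n\<close> are
      close and uniform continuity carries the small gradient back to \<open>m\<close>. If
      \<open>n = m\<close> the stretch is empty.\<close>
    define n where "n = (LEAST n. m \<le> n \<and> norm (gradient f (x n)) < \<epsilon> / 2)"
    have "\<exists>n. m \<le> n \<and> norm (gradient f (x n)) < \<epsilon> / 2"
      using frequently_small_gradient[OF half] by (auto simp: frequently_sequentially)
    then have n: "m \<le> n \<and> norm (gradient f (x n)) < \<epsilon> / 2"
      unfolding n_def by (rule LeastI_ex)
    have "\<epsilon> / 2 \<le> norm (gradient f (x j))" if "m \<le> j" "j < n" for j
      using not_less_Least[of j] that unfolding n_def by force
    then have "norm (x n - x m) < r"
      using N[OF \<open>N \<le> m\<close>] n by blast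
    then have "dist (gradient f (x n)) (gradient f (x m)) < \<epsilon> / 2"
      using X by (intro r(2)) (auto simp: dist_norm)
    then show ?thesis
      using n norm_triangle_sub[of "gradient f (x m)" "gradient f (x n)"]
      by (simp add: dist_norm norm_minus_commute)
  qed
  then show "\<exists>N. \<forall>m\<ge>N. norm (gradient f (x m) - 0) < \<epsilon>"
    by auto
qed

end

theorem theorem3p5:
  fixes f :: "real ^ 'n \<Rightarrow> real"
    and x :: "nat \<Rightarrow> real ^ 'n"
    and \<mu> :: "nat \<Rightarrow> real"
    and B :: "nat \<Rightarrow> real ^ 'n ^ 'n"
    and X :: "(real ^ 'n) set"
    and pmin c1 c2 \<sigma>1 \<sigma>2 :: real
  assumes "twice_continuously_differentiable f"
    and "bdd_below (range f)"
    and "\<mu> 0 > 0"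
    and "0 < pmin" "pmin < 1"
    and "0 < c1" "c1 < 1"
    and "c1 < c2" "c2 < 1"
    and "0 < \<sigma>1" "\<sigma>1 < 1"
    and "\<sigma>2 > 1"
    and "\<And>k. rqn_step f pmin c1 c2 \<sigma>1 \<sigma>2 (B k) (x k) (\<mu> k) (x (Suc k)) (\<mu> (Suc k))"
    and "bounded (range B)"
    and "uniformly_continuous_on X (gradient f)"
    and "range x \<subseteq> X"
  shows "(\<lambda>k. norm (gradient f (x k))) \<longlonglongrightarrow> 0 \<and>
         (\<forall>a. accumulation_point x a \<longrightarrow> gradient f a = 0)"
proof -
  have diff: "\<And>y. f differentiable (at y)"
    using assms(1) by (simp add: twice_continuously_differentiable_def)
  have cont: "continuous_on UNIV (gradient f)"
    using assms(1) unfolding twice_continuously_differentiable_def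
    by (metis continuous_at_imp_continuous_on has_derivative_continuous)
  obtain M where M: "0 \<le> M" "\<And>k v. norm (B k *v v) \<le> M * norm v"
    using bounded_matrices_uniform_bound[OF assms(14)] by blast
  interpret rqn_sequence f x \<mu> B pmin c1 c2 \<sigma>1 \<sigma>2 M
    by unfold_locales (fact assms diff cont M)+
  have lim: "(\<lambda>k. gradient f (x k)) \<longlonglongrightarrow> 0"
    using assms(15,16) by (rule gradient_tendsto_zero)
  have "gradient f a = 0" if acc: "accumulation_point x a" for a
  proof -
    obtain r where r: "strict_mono r" "(x \<circ> r) \<longlonglongrightarrow> a"
      using acc by (auto simp: accumulation_point_def)
    \<comment> \<open>The point \<open>a\<close> may lie outside \<open>X\<close>, so continuity on
      the whole space is used here.\<close>
    have "isCont (gradient f) a"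
      using cont by (simp add: continuous_on_eq_continuous_at)
    then have "(\<lambda>k. gradient f ((x \<circ> r) k)) \<longlonglongrightarrow> gradient f a"
      using r(2) by (rule isCont_tendsto_compose)
    moreover have "(\<lambda>k. gradient f ((x \<circ> r) k)) \<longlonglongrightarrow> 0"
      using LIMSEQ_subseq_LIMSEQ[OF lim r(1)] by (simp add: o_def)
    ultimately show ?thesis
      by (rule LIMSEQ_unique)
  qed
  with tendsto_norm_zero[OF lim] show ?thesis by blast
qed

end
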